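(* Let $G=(V,E)$ be a finite directed graph and let $a,b\in V$ be two distinct vertices. Then all $(a,b)$-paths pass through all $(a,b)$-bridges in the same order; that is, for any two distinct $(a,b)$-bridges $e,e'\in E$ and any two $(a,b)$-paths $p,q$, the edge $e$ precedes $e'$ along $p$ if and only if $e$ precedes $e'$ along $q$.
   Context: Directed graphs have no loops; parallel edges (directed similarly or oppositely) are allowed. An $(a,b)$-path is a directed path (without repeated vertices) from $a$ to $b$. An edge $e\in E$ is called an $(a,b)$-bridge if it belongs to every $(a,b)$-path. *)

theory Defs
  imports "Graph_Theory.Graph_Theory"
begin

definition (in pre_digraph) bridge :: "'a \<Rightarrow> 'a \<Rightarrow> 'b \<Rightarrow> bool" where
  "bridge a b e \<longleftrightarrow> e \<in> arcs G \<and> (\<forall>p. apath a p b \<longrightarrow> e \<in> set p)"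

definition precedes_in :: "'b list \<Rightarrow> 'b \<Rightarrow> 'b \<Rightarrow> bool" where
  "precedes_in p e e' \<longleftrightarrow> (\<exists>i j. i < j \<and> j < length p \<and> p ! i = e \<and> p ! j = e')"

end

theory Submission
  imports Defs
begin

text \<open>If \<open>e\<close> preceded \<open>e'\<close> along \<open>p\<close> but not along \<open>q\<close>, then following \<open>p\<close> from \<open>a\<close> through \<open>e\<close> and
  then \<open>q\<close> to \<open>b\<close> gives a walk avoiding \<open>e'\<close>; shortcutting it to a path contradicts that \<open>e'\<close> is
  a bridge.\<close>

text \<open>Trades indices for a split at \<open>e\<close>, the form in which walks can be cut and
  glued.\<close>

lemma precedes_in_iff_append:
  "precedes_in p e e' \<longleftrightarrow> (\<exists>xs ys. p = xs @ e # ys \<and> e' \<in> set ys)"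
proof
  assume "precedes_in p e e'"
  then obtain i j where ij: "i < j" "j < length p" "p ! i = e" "p ! j = e'"
    by (auto simp: precedes_in_def)
  then have "p = take i p @ e # drop (Suc i) p"
    by (metis id_take_nth_drop less_trans)
  moreover have "e' \<in> set (drop (Suc i) p)"
    using ij by (auto simp: in_set_conv_nth intro!: exI[of _ "j - Suc i"])
  ultimately show "\<exists>xs ys. p = xs @ e # ys \<and> e' \<in> set ys" by blast
next
  assume "\<exists>xs ys. p = xs @ e # ys \<and> e' \<in> set ys"
  then obtain xs ys k where "p = xs @ e # ys" "k < length ys" "ys ! k = e'"
    by (auto simp: in_set_conv_nth)
  then show "precedes_in p e e'"
    unfolding precedes_in_def
    by (intro exI[of _ "length xs"] exI[of _ "length xs + Suc k"]) (auto simp: nth_append)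
qed

text \<open>Shortcutting a walk to a path only deletes arcs, so a bridge found on the path was
  already on the walk.\<close>

lemma (in wf_digraph) bridge_in_awalk:
  assumes "bridge a b e" and "awalk a p b"
  shows "e \<in> set p"
  using assms apath_awalk_to_apath[OF assms(2)] awalk_to_apath_subset[OF assms(2)]
  by (auto simp: bridge_def)

lemma (in wf_digraph) apath_imp_distinct:
  assumes "apath a p b"
  shows "distinct p"
  using assms by (auto simp: apath_def intro: distinct_verts_imp_distinct)

lemma (in wf_digraph) bridge_precedes_in_transfer:
  assumes "bridge a b e" and "bridge a b e'" and "e \<noteq> e'"
    and p: "apath a p b" and q: "apath a q b" and "precedes_in p e e'"
  shows "precedes_in q e e'"
proof -
  obtain p1 p2 where p_split: "p = p1 @ e # p2" and "e' \<in> set p2"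
    using \<open>precedes_in p e e'\<close> by (auto simp: precedes_in_iff_append)
  have "e \<in> set q" using \<open>bridge a b e\<close> q by (auto simp: bridge_def)
  then obtain q1 q2 where q_split: "q = q1 @ e # q2" by (meson split_list)
  \<comment> \<open>The two pieces meet at the head of \<open>e\<close>. The result may repeat
    vertices, so it is only a walk.\<close>
  have "awalk a (p1 @ e # q2) b"
    using p q by (auto simp: p_split q_split apath_def awalk_simps)
  then have "e' \<in> set (p1 @ e # q2)"
    using \<open>bridge a b e'\<close> by (rule bridge_in_awalk[rotated])
  \<comment> \<open>A path repeats no arc, and \<open>e'\<close> already occurs after
    \<open>e\<close> on \<open>p\<close>.\<close>
  moreover have "e' \<notin> set p1"
    using apath_imp_distinct[OF p] \<open>e' \<in> set p2\<close> by (auto simp: p_split)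
  ultimately have "e' \<in> set q2" using \<open>e \<noteq> e'\<close> by auto
  then show ?thesis by (auto simp: precedes_in_iff_append q_split)
qed

theorem proposition2:
  fixes G :: "('a, 'b) pre_digraph" and a b :: 'a and e e' :: 'b and p q :: "'b awalk"
  assumes "fin_digraph G" and "loopfree_digraph G"
    and "a \<in> verts G" and "b \<in> verts G" and "a \<noteq> b"
    and "pre_digraph.bridge G a b e" and "pre_digraph.bridge G a b e'" and "e \<noteq> e'"
    and "pre_digraph.apath G a p b" and "pre_digraph.apath G a q b"
  shows "precedes_in p e e' \<longleftrightarrow> precedes_in q e e'"
proof -
  interpret fin_digraph G by fact
  \<comment> \<open>The converse is the same transfer with \<open>p\<close> and \<open>q\<close>
    swapped.\<close>
  show ?thesis using assms bridge_precedes_in_transfer by blast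
qed

end
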